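(* Let $(X,d)$ be a Polish ultrametric space, and let the pseudo-ultrametrics $d_\alpha$ on $X$ and the maps $\pi^\beta_\alpha$, for ordinals $\beta<\alpha$, be defined by the transfinite recursion described in the context. Then, for all ordinals $\alpha$: (1) $d_\beta(x,y)\geq d_\alpha(x,y)$ for every $x,y\in X$ and every $\beta<\alpha$; (2) the pseudo-ultrametric $d_\alpha$ induces an ultrametric on $X/d_\alpha$; (3) if $\alpha$ is a limit ordinal, then $[\![x]\!]_\alpha=\mathrm{cl}_X\big(\bigcup_{\beta<\alpha}[\![x]\!]_\beta\big)$ for every $x\in X$; in particular, $[\![x]\!]_\alpha$ is closed in $X$ for every $x\in X$; (4) $X/d_\alpha$ is complete, and so it is a Polish ultrametric space; (5) there exists $\alpha_s<\omega_1$ such that $d_{\alpha_s+1}=d_{\alpha_s}$; in other words, $X/d_{\alpha_s}$ is rigid; (6) if $\alpha$ is a limit ordinal, then $X/d_\alpha$ is the direct limit of the system $\{X/d_\beta\}_{\beta<\alpha}$ with mappings $\{\pi^\gamma_\beta\}_{\gamma<\beta<\alpha}$, that is, it satisfies the universal property of the direct limit with metric maps as morphisms.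
   Context: A metric space is ultrametric if $d(x,z)\le\max\{d(x,y),d(y,z)\}$ for all $x,y,z$; it is Polish if it is separable and complete. $\mathrm{Iso}(X)$ is the group of all distance-preserving bijections of $X$; a space is rigid if its isometry group is trivial. For a Polish ultrametric space $Y$, let $\pi(y)\subseteq Y$ denote the orbit of $y\in Y$ under $\mathrm{Iso}(Y)$. The formula $\mathrm{dist}(\pi(y),\pi(y'))$ (infimum of distances between points of the two orbits) defines a complete ultrametric on the set of orbits, and every orbit is closed (known facts). For a pseudo-ultrametric $d_\alpha$ on $X$, $X/d_\alpha$ is its metric identification: the set of equivalence classes $[\![x]\!]_\alpha=\{y\in X: d_\alpha(x,y)=0\}$ with the induced distance. Define by transfinite recursion over all ordinals: $d_0=d$; $d_{\alpha+1}(x,y)=\mathrm{dist}(\pi([\![x]\!]_\alpha),\pi([\![y]\!]_\alpha))$, where $\pi$ sends a point of $X/d_\alpha$ to its orbit under $\mathrm{Iso}(X/d_\alpha)$ and $\mathrm{dist}$ is computed in $X/d_\alpha$; and $d_\alpha(x,y)=\inf\{d_\beta(x,y):\beta<\alpha\}$ for limit $\alpha$. For $\beta<\alpha$ define $\pi^\beta_\alpha: X/d_\beta\to X/d_\alpha$ by $\pi^\beta_\alpha([\![x]\!]_\beta)=[\![x]\!]_\alpha$. A metric map is a $1$-Lipschitz (distance non-increasing) map between metric spaces. The direct limit in (6), with structure maps $\pi^\beta_\alpha$, $\beta<\alpha$, is taken in metric spaces with metric maps: for every metric space $Y$ and every family of metric maps $f_\beta:X/d_\beta\to Y$, $\beta<\alpha$,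 with $f_\beta\circ\pi^\gamma_\beta=f_\gamma$ for $\gamma<\beta<\alpha$, there is a unique metric map $f:X/d_\alpha\to Y$ with $f\circ\pi^\beta_\alpha=f_\beta$ for all $\beta<\alpha$. *)

theory Defs
  imports "HOL-Analysis.Analysis"
begin

text \<open>Spaces are given by a carrier set and a distance function, as in \<^locale>\<open>Metric_space\<close>.
  That locale asks for nonnegativity and symmetry on the whole type, which any distance on the
  carrier satisfies after redefining it as \<open>0\<close> elsewhere; otherwise only the values on the carrier
  matter.\<close>

definition ultrametric_space :: "'a set \<Rightarrow> ('a \<Rightarrow> 'a \<Rightarrow> real) \<Rightarrow> bool" where
  "ultrametric_space M d \<longleftrightarrow>
     Metric_space M d \<and> (\<forall>x\<in>M. \<forall>y\<in>M. \<forall>z\<in>M. d x z \<le> max (d x y) (d y z))"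

definition pseudo_ultrametric :: "'a set \<Rightarrow> ('a \<Rightarrow> 'a \<Rightarrow> real) \<Rightarrow> bool" where
  "pseudo_ultrametric M d \<longleftrightarrow>
     (\<forall>x\<in>M. \<forall>y\<in>M. 0 \<le> d x y) \<and> (\<forall>x\<in>M. d x x = 0) \<and>
     (\<forall>x\<in>M. \<forall>y\<in>M. d x y = d y x) \<and>
     (\<forall>x\<in>M. \<forall>y\<in>M. \<forall>z\<in>M. d x z \<le> max (d x y) (d y z))"

definition Polish_ultrametric_space :: "'a set \<Rightarrow> ('a \<Rightarrow> 'a \<Rightarrow> real) \<Rightarrow> bool" where
  "Polish_ultrametric_space M d \<longleftrightarrow>
     ultrametric_space M d \<and> separable_space (Metric_space.mtopology M d) \<and>
     Metric_space.mcomplete M d"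

definition metric_map ::
  "'a set \<Rightarrow> ('a \<Rightarrow> 'a \<Rightarrow> real) \<Rightarrow> 'b set \<Rightarrow> ('b \<Rightarrow> 'b \<Rightarrow> real) \<Rightarrow> ('a \<Rightarrow> 'b) \<Rightarrow> bool" where
  "metric_map M d N e f \<longleftrightarrow> f \<in> M \<rightarrow> N \<and> (\<forall>x\<in>M. \<forall>y\<in>M. e (f x) (f y) \<le> d x y)"

text \<open>Isometries are made extensional so that each one is a single HOL function.\<close>

definition Iso :: "'a set \<Rightarrow> ('a \<Rightarrow> 'a \<Rightarrow> real) \<Rightarrow> ('a \<Rightarrow> 'a) set" where
  "Iso M d = {g \<in> extensional M. bij_betw g M M \<and> (\<forall>x\<in>M. \<forall>y\<in>M. d (g x) (g y) = d x y)}"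

definition rigid :: "'a set \<Rightarrow> ('a \<Rightarrow> 'a \<Rightarrow> real) \<Rightarrow> bool" where
  "rigid M d \<longleftrightarrow> Iso M d = {\<lambda>x\<in>M. x}"

definition Iso_orbit :: "'a set \<Rightarrow> ('a \<Rightarrow> 'a \<Rightarrow> real) \<Rightarrow> 'a \<Rightarrow> 'a set" where
  "Iso_orbit M d y = {g y | g. g \<in> Iso M d}"

definition set_dist :: "('a \<Rightarrow> 'a \<Rightarrow> real) \<Rightarrow> 'a set \<Rightarrow> 'a set \<Rightarrow> real" where
  "set_dist d A B = Inf {d a b | a b. a \<in> A \<and> b \<in> B}"


subsection \<open>Metric identification\<close>

definition mclass :: "'a set \<Rightarrow> ('a \<Rightarrow> 'a \<Rightarrow> real) \<Rightarrow> 'a \<Rightarrow> 'a set" where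
  "mclass M d x = {y \<in> M. d x y = 0}"

definition mquot :: "'a set \<Rightarrow> ('a \<Rightarrow> 'a \<Rightarrow> real) \<Rightarrow> 'a set set" where
  "mquot M d = mclass M d ` M"

text \<open>The common value of \<open>d\<close> on representatives; it exists when \<open>d\<close> is a pseudometric.
  The value \<open>0\<close> off the quotient is forced by \<^locale>\<open>Metric_space\<close>, which requires
  nonnegativity and symmetry on the whole type.\<close>

definition mquot_dist :: "'a set \<Rightarrow> ('a \<Rightarrow> 'a \<Rightarrow> real) \<Rightarrow> 'a set \<Rightarrow> 'a set \<Rightarrow> real" where
  "mquot_dist M d A B =
     (if A \<in> mquot M d \<and> B \<in> mquot M d then THE t. \<forall>a\<in>A. \<forall>b\<in>B. d a b = t else 0)"


subsection \<open>Ordinals\<close>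

text \<open>An ordinal \<open>\<alpha>\<close> is represented by an element \<open>a\<close> of the field of a well-order \<open>r\<close> (on an
  arbitrary type) such that \<open>underS r a\<close>, the set of strict predecessors of \<open>a\<close>, has order
  type \<open>\<alpha>\<close>. Then \<open>\<beta> < \<alpha>\<close> becomes \<open>b \<in> underS r a\<close>.\<close>

definition is_succ :: "'o rel \<Rightarrow> 'o \<Rightarrow> 'o \<Rightarrow> bool" where
  "is_succ r b a \<longleftrightarrow> b \<in> underS r a \<and> (\<forall>c\<in>underS r a. (c, b) \<in> r)"

definition is_limit :: "'o rel \<Rightarrow> 'o \<Rightarrow> bool" where
  "is_limit r a \<longleftrightarrow> a \<in> Field r \<and> underS r a \<noteq> {} \<and> (\<nexists>b. is_succ r b a)"

text \<open>The elements of \<^term>\<open>Field omega_1\<close> represent exactly the countable ordinals.\<close>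

definition omega_1 :: "nat set rel" where
  "omega_1 = cardSuc natLeq"


subsection \<open>The transfinite sequence of pseudo-ultrametrics\<close>

definition orbit_dist :: "'a set \<Rightarrow> ('a \<Rightarrow> 'a \<Rightarrow> real) \<Rightarrow> 'a \<Rightarrow> 'a \<Rightarrow> real" where
  "orbit_dist M d x y =
     set_dist (mquot_dist M d)
       (Iso_orbit (mquot M d) (mquot_dist M d) (mclass M d x))
       (Iso_orbit (mquot M d) (mquot_dist M d) (mclass M d y))"

definition dseq_step ::
  "'a set \<Rightarrow> ('a \<Rightarrow> 'a \<Rightarrow> real) \<Rightarrow> 'o rel \<Rightarrow> ('o \<Rightarrow> 'a \<Rightarrow> 'a \<Rightarrow> real) \<Rightarrow> 'o \<Rightarrow> 'a \<Rightarrow> 'a \<Rightarrow> real" where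
  "dseq_step M d r D a =
     (if underS r a = {} then d
      else if \<exists>b. is_succ r b a then orbit_dist M (D (THE b. is_succ r b a))
      else (\<lambda>x y. INF b\<in>underS r a. D b x y))"

text \<open>The defining recursion equations are the lemmas \<open>dseq_zero\<close>, \<open>dseq_succ\<close> and
  \<open>dseq_limit\<close> below; \<open>dseq_embed\<close> shows that \<open>dseq M d r a\<close> depends only on the ordinal
  represented by \<open>a\<close>, not on \<open>r\<close>.\<close>

definition dseq :: "'a set \<Rightarrow> ('a \<Rightarrow> 'a \<Rightarrow> real) \<Rightarrow> 'o rel \<Rightarrow> 'o \<Rightarrow> 'a \<Rightarrow> 'a \<Rightarrow> real" where
  "dseq M d r = wo_rel.worec r (dseq_step M d r)"

lemma is_succ_unique:
  assumes "Well_order r" "is_succ r b a" "is_succ r b' a"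
  shows "b = b'"
proof -
  interpret wo_rel r using assms(1) by (rule wo_rel.intro)
  show ?thesis using assms(2,3) ANTISYM unfolding is_succ_def antisym_def by blast
qed

lemma is_succ_The:
  assumes "Well_order r" "is_succ r b a"
  shows "(THE b. is_succ r b a) = b"
  using assms is_succ_unique by (metis the_equality)

lemma dseq_unfold:
  assumes "Well_order r"
  shows "dseq M d r a = dseq_step M d r (dseq M d r) a"
proof -
  interpret wo_rel r using assms by (rule wo_rel.intro)
  have "dseq_step M d r f x = dseq_step M d r g x"
    if eq: "\<forall>y\<in>underS x. f y = g y" for f g x
  proof -
    have "f (THE b. is_succ r b x) = g (THE b. is_succ r b x)" if "\<exists>b. is_succ r b x"
    proof -
      from that obtain b where b: "is_succ r b x" ..
      then have "b \<in> underS x" unfolding is_succ_def by blast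
      with eq show ?thesis by (simp add: is_succ_The[OF assms b])
    qed
    moreover have "(\<lambda>u v. INF b\<in>underS x. f b u v) = (\<lambda>u v. INF b\<in>underS x. g b u v)"
      using eq by (intro ext INF_cong) auto
    ultimately show ?thesis unfolding dseq_step_def by simp
  qed
  then have "adm_wo (dseq_step M d r)"
    unfolding adm_wo_def by blast
  from fun_cong[OF worec_fixpoint[OF this], of a] show ?thesis unfolding dseq_def .
qed

lemma dseq_zero:
  assumes "Well_order r" "underS r a = {}"
  shows "dseq M d r a = d"
  using assms by (simp add: dseq_unfold[of r M d a] dseq_step_def)

lemma dseq_succ:
  assumes "Well_order r" "is_succ r b a"
  shows "dseq M d r a = orbit_dist M (dseq M d r b)"
proof -
  have "underS r a \<noteq> {}" using assms(2) unfolding is_succ_def by blast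
  with assms show ?thesis
    by (auto simp: dseq_unfold[of r M d a] dseq_step_def is_succ_The)
qed

lemma dseq_limit:
  assumes "Well_order r" "is_limit r a"
  shows "dseq M d r a x y = (INF b\<in>underS r a. dseq M d r b x y)"
  using assms by (simp add: dseq_unfold[of r M d a] dseq_step_def is_limit_def)

lemma dseq_embed:
  assumes r: "Well_order r" and r': "Well_order r'" and f: "embed r r' f" and "a \<in> Field r"
  shows "dseq M d r' (f a) = dseq M d r a"
proof -
  interpret wo_rel r using r by (rule wo_rel.intro)
  have "a \<in> Field r \<longrightarrow> dseq M d r' (f a) = dseq M d r a"
  proof (induction a rule: well_order_induct)
    case (1 a)
    show ?case
    proof
      assume a: "a \<in> Field r"
      have bij: "bij_betw f (underS a) (Order_Relation.underS r' (f a))"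
        using embed_underS[OF r f a] .
      then have im: "Order_Relation.underS r' (f a) = f ` underS a"
        and inj: "inj_on f (underS a)" by (auto simp: bij_betw_def)
      have IH: "dseq M d r' (f b) = dseq M d r b" if "b \<in> underS a" for b
        using 1 that by (auto simp: underS_def Field_def)
      have compat: "(f u, f v) \<in> r' \<longleftrightarrow> (u, v) \<in> r" if "u \<in> underS a" "v \<in> underS a" for u v
      proof
        assume uv: "(f u, f v) \<in> r'"
        have F: "u \<in> Field r" "v \<in> Field r" using that by (auto simp: underS_def Field_def)
        show "(u, v) \<in> r"
        proof (rule ccontr)
          assume "(u, v) \<notin> r"
          then have "(v, u) \<in> r" and "u \<noteq> v"
            using F TOTALS REFL by (auto simp: refl_on_def)
          then have "(f v, f u) \<in> r'" using embed_compat[OF f] by (auto simp: compat_def)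
          then have "f u = f v" using uv wo_rel.ANTISYM[OF wo_rel.intro[OF r']]
            by (auto simp: antisym_def)
          with inj that \<open>u \<noteq> v\<close> show False by (auto simp: inj_on_def)
        qed
      next
        assume "(u, v) \<in> r"
        then show "(f u, f v) \<in> r'" using embed_compat[OF f] by (auto simp: compat_def)
      qed
      have succ: "is_succ r' (f b) (f a) \<longleftrightarrow> is_succ r b a" if "b \<in> underS a" for b
        using that compat unfolding is_succ_def im by auto
      consider (z) "underS a = {}" | (s) b where "is_succ r b a" | (l) "is_limit r a"
        using a unfolding is_limit_def by blast
      then show "dseq M d r' (f a) = dseq M d r a"
      proof cases
        case z
        then show ?thesis using im by (simp add: dseq_zero r r')
      next
        case s
        then have b: "b \<in> underS a" unfolding is_succ_def by blast
        then have "is_succ r' (f b) (f a)" using succ s by blast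
        then show ?thesis by (simp add: dseq_succ[OF r s] dseq_succ[OF r'] IH[OF b])
      next
        case l
        have "is_limit r' (f a)"
          using l succ embed_in_Field[OF f a] im
          unfolding is_limit_def by (auto simp: is_succ_def)
        then show ?thesis
          using IH
          by (intro ext) (simp add: dseq_limit[OF r l] dseq_limit[OF r'] im image_image)
      qed
    qed
  qed
  with assms(4) show ?thesis by blast
qed


text \<open>The space \<open>X/d\<^sub>\<alpha>\<close> with its distance, and the map \<open>\<pi>\<^sup>\<beta>\<^sub>\<alpha>\<close>. The latter sends a \<open>d\<^sub>\<beta>\<close>-class
  to the \<open>d\<^sub>\<alpha>\<close>-class of any of its members.\<close>

abbreviation seq_class :: "'a set \<Rightarrow> ('a \<Rightarrow> 'a \<Rightarrow> real) \<Rightarrow> 'o rel \<Rightarrow> 'o \<Rightarrow> 'a \<Rightarrow> 'a set" where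
  "seq_class M d r a \<equiv> mclass M (dseq M d r a)"

abbreviation seq_quot :: "'a set \<Rightarrow> ('a \<Rightarrow> 'a \<Rightarrow> real) \<Rightarrow> 'o rel \<Rightarrow> 'o \<Rightarrow> 'a set set" where
  "seq_quot M d r a \<equiv> mquot M (dseq M d r a)"

abbreviation seq_quot_dist ::
  "'a set \<Rightarrow> ('a \<Rightarrow> 'a \<Rightarrow> real) \<Rightarrow> 'o rel \<Rightarrow> 'o \<Rightarrow> 'a set \<Rightarrow> 'a set \<Rightarrow> real" where
  "seq_quot_dist M d r a \<equiv> mquot_dist M (dseq M d r a)"

definition seq_proj ::
  "'a set \<Rightarrow> ('a \<Rightarrow> 'a \<Rightarrow> real) \<Rightarrow> 'o rel \<Rightarrow> 'o \<Rightarrow> 'o \<Rightarrow> 'a set \<Rightarrow> 'a set" where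
  "seq_proj M d r b a =
     (\<lambda>A\<in>seq_quot M d r b. THE C. \<forall>x\<in>A. C = seq_class M d r a x)"


subsection \<open>Direct limits in metric spaces with metric maps\<close>

text \<open>A system over the strict predecessors of \<open>a\<close>: spaces \<open>(S b, D b)\<close> and bonding maps
  \<open>p c b\<close> from \<open>S c\<close> to \<open>S b\<close> for \<open>c < b\<close>. Maps out of \<open>S b\<close> are compared on \<open>S b\<close> only.\<close>

definition direct_system ::
  "'o rel \<Rightarrow> 'o \<Rightarrow> ('o \<Rightarrow> 'b set) \<Rightarrow> ('o \<Rightarrow> 'b \<Rightarrow> 'b \<Rightarrow> real) \<Rightarrow> ('o \<Rightarrow> 'o \<Rightarrow> 'b \<Rightarrow> 'b) \<Rightarrow> bool" where
  "direct_system r a S D p \<longleftrightarrow>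
     (\<forall>b\<in>underS r a. Metric_space (S b) (D b)) \<and>
     (\<forall>b\<in>underS r a. \<forall>c\<in>underS r b. metric_map (S c) (D c) (S b) (D b) (p c b)) \<and>
     (\<forall>b\<in>underS r a. \<forall>c\<in>underS r b. \<forall>e\<in>underS r c. \<forall>A\<in>S e. p c b (p e c A) = p e b A)"

definition cocone ::
  "'o rel \<Rightarrow> 'o \<Rightarrow> ('o \<Rightarrow> 'b set) \<Rightarrow> ('o \<Rightarrow> 'b \<Rightarrow> 'b \<Rightarrow> real) \<Rightarrow> ('o \<Rightarrow> 'o \<Rightarrow> 'b \<Rightarrow> 'b) \<Rightarrow>
   'y set \<Rightarrow> ('y \<Rightarrow> 'y \<Rightarrow> real) \<Rightarrow> ('o \<Rightarrow> 'b \<Rightarrow> 'y) \<Rightarrow> bool" where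
  "cocone r a S D p Y e f \<longleftrightarrow>
     Metric_space Y e \<and>
     (\<forall>b\<in>underS r a. metric_map (S b) (D b) Y e (f b)) \<and>
     (\<forall>b\<in>underS r a. \<forall>c\<in>underS r b. \<forall>A\<in>S c. f b (p c b A) = f c A)"

text \<open>The universal property with respect to one test cocone \<open>(Y, e, f)\<close>. A HOL definition
  cannot quantify over the type of \<open>Y\<close>, so \<open>Y\<close> is a parameter. The mediating map is made
  extensional so that uniqueness is meant on \<open>L\<close>.\<close>

definition factors_uniquely ::
  "'o rel \<Rightarrow> 'o \<Rightarrow> ('o \<Rightarrow> 'b set) \<Rightarrow> 'l set \<Rightarrow> ('l \<Rightarrow> 'l \<Rightarrow> real) \<Rightarrow> ('o \<Rightarrow> 'b \<Rightarrow> 'l) \<Rightarrow>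
   'y set \<Rightarrow> ('y \<Rightarrow> 'y \<Rightarrow> real) \<Rightarrow> ('o \<Rightarrow> 'b \<Rightarrow> 'y) \<Rightarrow> bool" where
  "factors_uniquely r a S L l i Y e f \<longleftrightarrow>
     (\<exists>!g. g \<in> extensional L \<and> metric_map L l Y e g \<and>
           (\<forall>b\<in>underS r a. \<forall>A\<in>S b. g (i b A) = f b A))"

end

theory Submission
  imports Defs "HOL-Library.Countable_Set_Type"
begin

text \<open>Every \<open>d\<^sub>\<alpha>\<close> has the lifting property: if \<open>d\<^sub>\<alpha> x y < e\<close>, then some \<open>x'\<close> with \<open>d\<^sub>\<alpha> x x' = 0\<close>
  satisfies \<open>d x' y < e\<close>. It passes to successors because a small orbit distance is witnessed by an
  isometry of \<open>X/d\<^sub>\<alpha>\<close>, and to limits because a small infimum is witnessed at an earlier stage. Hence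
  fast Cauchy sequences in \<open>X/d\<^sub>\<alpha>\<close> lift to Cauchy sequences in \<open>X\<close>, which gives completeness, and
  classes at limits are closures. For the stabilization, a decreasing \<open>\<omega>\<^sub>1\<close>-sequence of reals is
  eventually constant; countably many such bounds, one for each pair from a countable dense set and
  each rational, have a common countable upper bound, and \<open>d\<^sub>\<alpha> \<le> d\<close> carries equality over to \<open>X\<close>.\<close>

section \<open>Metric identification of a pseudo-ultrametric\<close>

lemma pseudo_ultrametricD:
  assumes "pseudo_ultrametric M D"
  shows "x \<in> M \<Longrightarrow> y \<in> M \<Longrightarrow> 0 \<le> D x y"
    and "x \<in> M \<Longrightarrow> D x x = 0"
    and "x \<in> M \<Longrightarrow> y \<in> M \<Longrightarrow> D x y = D y x"
    and "x \<in> M \<Longrightarrow> y \<in> M \<Longrightarrow> z \<in> M \<Longrightarrow> D x z \<le> max (D x y) (D y z)"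
  using assms unfolding pseudo_ultrametric_def by blast+

lemma pseudo_ultrametric_less_trans:
  assumes "pseudo_ultrametric M D" "x \<in> M" "y \<in> M" "z \<in> M" "D x y < e" "D y z < e"
  shows "D x z < e"
  using pseudo_ultrametricD(4)[OF assms(1-4)] assms(5,6) by linarith

lemma pseudo_ultrametric_if_ultrametric_space:
  assumes "ultrametric_space M d"
  shows "pseudo_ultrametric M d"
proof -
  interpret Metric_space M d using assms by (simp add: ultrametric_space_def)
  show ?thesis
    using assms commute unfolding pseudo_ultrametric_def ultrametric_space_def by auto
qed

lemma mclass_self:
  assumes "pseudo_ultrametric M D" "x \<in> M"
  shows "x \<in> mclass M D x"
  using assms by (simp add: mclass_def pseudo_ultrametricD)

lemma pseudo_ultrametric_cong_zero:
  assumes D: "pseudo_ultrametric M D" and M: "x \<in> M" "x' \<in> M" "y \<in> M" and 0: "D x x' = 0"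
  shows "D x' y = D x y"
proof (rule antisym)
  have "D x' x = 0" using pseudo_ultrametricD(3)[OF D] M 0 by metis
  then show "D x' y \<le> D x y"
    using pseudo_ultrametricD(4)[OF D, of x' x y] pseudo_ultrametricD(1)[OF D, of x y] M by simp
  show "D x y \<le> D x' y"
    using pseudo_ultrametricD(4)[OF D, of x x' y] pseudo_ultrametricD(1)[OF D, of x' y] M 0 by simp
qed

lemma mclass_eq_iff:
  assumes D: "pseudo_ultrametric M D" and M: "x \<in> M" "y \<in> M"
  shows "mclass M D x = mclass M D y \<longleftrightarrow> D x y = 0"
proof
  assume "mclass M D x = mclass M D y"
  then show "D x y = 0" using mclass_self[OF D M(2)] by (auto simp: mclass_def)
next
  assume "D x y = 0"
  then show "mclass M D x = mclass M D y"
    using pseudo_ultrametric_cong_zero[OF D M] unfolding mclass_def by auto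
qed

lemma mclass_in_mquot: "x \<in> M \<Longrightarrow> mclass M D x \<in> mquot M D"
  by (simp add: mquot_def)

lemma mquotE:
  assumes "A \<in> mquot M D"
  obtains x where "x \<in> M" "A = mclass M D x"
  using assms unfolding mquot_def by blast

text \<open>Moving one argument at a time along points at distance zero shows that \<open>D\<close>
  is constant on the product of two classes. As classes are nonempty, the definite description in
  \<open>mquot_dist\<close> then has exactly one candidate.\<close>

lemma mquot_dist_mclass:
  assumes D: "pseudo_ultrametric M D" and M: "x \<in> M" "y \<in> M"
  shows "mquot_dist M D (mclass M D x) (mclass M D y) = D x y"
proof -
  have eq: "D a b = D x y" if "a \<in> mclass M D x" "b \<in> mclass M D y" for a b
  proof -
    from that have ab: "a \<in> M" "b \<in> M" "D x a = 0" "D y b = 0" by (auto simp: mclass_def)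
    have "D a b = D x b" using pseudo_ultrametric_cong_zero[OF D] M ab by blast
    also have "\<dots> = D b x" using pseudo_ultrametricD(3)[OF D] M ab by blast
    also have "\<dots> = D y x" using pseudo_ultrametric_cong_zero[OF D] M ab by blast
    also have "\<dots> = D x y" using pseudo_ultrametricD(3)[OF D] M by blast
    finally show ?thesis .
  qed
  have "(THE t. \<forall>a\<in>mclass M D x. \<forall>b\<in>mclass M D y. D a b = t) = D x y"
  proof (rule the_equality)
    show "\<forall>a\<in>mclass M D x. \<forall>b\<in>mclass M D y. D a b = D x y" using eq by blast
  next
    fix t assume "\<forall>a\<in>mclass M D x. \<forall>b\<in>mclass M D y. D a b = t"
    then show "t = D x y" using mclass_self[OF D] M by auto
  qed
  then show ?thesis using M by (simp add: mquot_dist_def mclass_in_mquot)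
qed

lemma ultrametric_space_mquot:
  assumes D: "pseudo_ultrametric M D"
  shows "ultrametric_space (mquot M D) (mquot_dist M D)"
proof -
  note q = mquot_dist_mclass[OF D]
  have tri: "mquot_dist M D A C \<le> max (mquot_dist M D A B) (mquot_dist M D B C)"
    if "A \<in> mquot M D" "B \<in> mquot M D" "C \<in> mquot M D" for A B C
    using that by (auto elim!: mquotE simp: q pseudo_ultrametricD(4)[OF D])
  \<comment> \<open>Here \<open>A\<close> and \<open>B\<close> are arbitrary sets:
    \<open>Metric_space\<close> asks for nonnegativity on the whole type, and off the quotient the
    default value 0 provides it. Symmetry below is treated the same way.\<close>
  have nonneg: "0 \<le> mquot_dist M D A B" for A B
  proof (cases "A \<in> mquot M D \<and> B \<in> mquot M D")
    case True
    then show ?thesis by (auto elim!: mquotE simp: q pseudo_ultrametricD(1)[OF D])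
  next
    case False
    then show ?thesis by (simp only: mquot_dist_def if_False)
  qed
  have "Metric_space (mquot M D) (mquot_dist M D)"
  proof
    fix A B C
    show "0 \<le> mquot_dist M D A B" by (rule nonneg)
    show "mquot_dist M D A B = mquot_dist M D B A"
    proof (cases "A \<in> mquot M D \<and> B \<in> mquot M D")
      case True
      then show ?thesis by (auto elim!: mquotE simp: q intro: pseudo_ultrametricD(3)[OF D])
    next
      case False
      then have "\<not> (B \<in> mquot M D \<and> A \<in> mquot M D)" by blast
      with False show ?thesis by (simp only: mquot_dist_def if_False)
    qed
    show "mquot_dist M D A B = 0 \<longleftrightarrow> A = B" if "A \<in> mquot M D" "B \<in> mquot M D"
    proof -
      from that obtain x y where "x \<in> M" "A = mclass M D x" "y \<in> M" "B = mclass M D y"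
        by (elim mquotE)
      then show ?thesis by (simp only: q mclass_eq_iff[OF D])
    qed
    assume "A \<in> mquot M D" "B \<in> mquot M D" "C \<in> mquot M D"
    then show "mquot_dist M D A C \<le> mquot_dist M D A B + mquot_dist M D B C"
      using tri[of A B C] nonneg[of A B] nonneg[of B C] by linarith
  qed
  with tri show ?thesis unfolding ultrametric_space_def by blast
qed

section \<open>The distance between orbits\<close>

lemma Iso_id: "(\<lambda>x\<in>M. x) \<in> Iso M d"
  by (auto simp: Iso_def bij_betw_def inj_on_def)

lemma IsoD:
  assumes "g \<in> Iso M d"
  shows "x \<in> M \<Longrightarrow> g x \<in> M" and "x \<in> M \<Longrightarrow> y \<in> M \<Longrightarrow> d (g x) (g y) = d x y"
  using assms unfolding Iso_def bij_betw_def by auto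

lemma Iso_comp:
  assumes "g \<in> Iso M d" "h \<in> Iso M d"
  shows "(\<lambda>x\<in>M. g (h x)) \<in> Iso M d"
proof -
  have "bij_betw (g \<circ> h) M M" using assms unfolding Iso_def by (auto intro: bij_betw_trans)
  then have "bij_betw (\<lambda>x\<in>M. g (h x)) M M" by (rule bij_betw_cong[THEN iffD1, rotated]) simp
  then show ?thesis using IsoD[OF assms(1)] IsoD[OF assms(2)] unfolding Iso_def by auto
qed

lemma Iso_inv:
  assumes g: "g \<in> Iso M d"
  obtains h where "h \<in> Iso M d" "\<forall>x\<in>M. h (g x) = x" "\<forall>x\<in>M. g (h x) = x"
proof
  let ?h = "\<lambda>x\<in>M. inv_into M g x"
  have bij: "bij_betw g M M" using g by (simp add: Iso_def)
  have "bij_betw (inv_into M g) M M" using bij by (rule bij_betw_inv_into)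
  then have hb: "bij_betw ?h M M" by (rule bij_betw_cong[THEN iffD1, rotated]) simp
  show gh: "\<forall>x\<in>M. g (?h x) = x"
    using bij by (simp add: bij_betw_inv_into_right)
  show "\<forall>x\<in>M. ?h (g x) = x"
    using bij IsoD(1)[OF g] by (simp add: bij_betw_inv_into_left)
  have "d (?h x) (?h y) = d x y" if "x \<in> M" "y \<in> M" for x y
  proof -
    have "?h x \<in> M" "?h y \<in> M" using hb that bij_betwE by fast+
    from IsoD(2)[OF g this] show ?thesis using gh that by simp
  qed
  then show "?h \<in> Iso M d" using hb unfolding Iso_def by auto
qed

text \<open>A strict bound turns the infimum into an existential statement about two isometries;
  applying the inverse of the one that moves \<open>y\<close> leaves a single isometry, acting on
  \<open>x\<close>.\<close>

lemma set_dist_orbits_less_iff: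
  assumes d: "ultrametric_space M d" and M: "x \<in> M" "y \<in> M"
  shows "set_dist d (Iso_orbit M d x) (Iso_orbit M d y) < e \<longleftrightarrow> (\<exists>g\<in>Iso M d. d (g x) y < e)"
proof -
  interpret Metric_space M d using d by (simp add: ultrametric_space_def)
  let ?S = "{d a b |a b. a \<in> Iso_orbit M d x \<and> b \<in> Iso_orbit M d y}"
  have ne: "?S \<noteq> {}" using Iso_id unfolding Iso_orbit_def by blast
  have bdd: "bdd_below ?S" by (rule bdd_belowI[of _ 0]) auto
  have "set_dist d (Iso_orbit M d x) (Iso_orbit M d y) < e \<longleftrightarrow> (\<exists>s\<in>?S. s < e)"
    unfolding set_dist_def using cInf_less_iff[OF ne bdd] by blast
  also have "\<dots> \<longleftrightarrow> (\<exists>g\<in>Iso M d. \<exists>h\<in>Iso M d. d (g x) (h y) < e)"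
    unfolding Iso_orbit_def by blast
  also have "\<dots> \<longleftrightarrow> (\<exists>g\<in>Iso M d. d (g x) y < e)"
  proof safe
    fix g h assume g: "g \<in> Iso M d" and h: "h \<in> Iso M d" and e: "d (g x) (h y) < e"
    obtain k where k: "k \<in> Iso M d" "\<forall>x\<in>M. k (h x) = x"
      "\<forall>x\<in>M. h (k x) = x"
      using h by (rule Iso_inv)
    have "d (k (g x)) y < e"
      using IsoD(2)[OF k(1), of "g x" "h y"] e M IsoD(1)[OF g] IsoD(1)[OF h] k(2) by simp
    then show "\<exists>g\<in>Iso M d. d (g x) y < e"
      using M by (intro bexI[OF _ Iso_comp[OF k(1) g]]) simp
  next
    fix g assume "g \<in> Iso M d" "d (g x) y < e"
    then show "\<exists>g\<in>Iso M d. \<exists>h\<in>Iso M d. d (g x) (h y) < e"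
      using M by (intro bexI[of _ g] bexI[OF _ Iso_id]) auto
  qed
  finally show ?thesis .
qed

text \<open>All later facts about \<open>orbit_dist\<close> go through this equivalence rather than
  through the infimum; non-strict inequalities are recovered with \<open>dense_ge\<close>.\<close>

lemma orbit_dist_less_iff:
  assumes D: "pseudo_ultrametric M D" and M: "x \<in> M" "y \<in> M"
  shows "orbit_dist M D x y < e \<longleftrightarrow>
    (\<exists>g\<in>Iso (mquot M D) (mquot_dist M D). mquot_dist M D (g (mclass M D x)) (mclass M D y) < e)"
  unfolding orbit_dist_def
  using set_dist_orbits_less_iff[OF ultrametric_space_mquot[OF D]] M by (simp add: mclass_in_mquot)

text \<open>The identity is one of the competing isometries.\<close>

lemma orbit_dist_le:
  assumes D: "pseudo_ultrametric M D" and M: "x \<in> M" "y \<in> M"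
  shows "orbit_dist M D x y \<le> D x y"
proof (rule dense_ge)
  fix e assume "D x y < e"
  then have "orbit_dist M D x y < e"
    unfolding orbit_dist_less_iff[OF D M]
    using M by (intro bexI[OF _ Iso_id]) (simp add: mclass_in_mquot mquot_dist_mclass[OF D])
  then show "orbit_dist M D x y \<le> e" by simp
qed

text \<open>The axioms mirror the group structure of the isometries: the identity gives distance
  zero from a point to itself, inverses give symmetry, and composition gives the ultrametric
  inequality.\<close>

lemma pseudo_ultrametric_orbit_dist:
  assumes D: "pseudo_ultrametric M D"
  shows "pseudo_ultrametric M (orbit_dist M D)"
proof -
  let ?Q = "mquot M D" and ?q = "mquot_dist M D" and ?c = "mclass M D"
  note us = ultrametric_space_mquot[OF D]
  interpret Metric_space ?Q ?q using us by (simp add: ultrametric_space_def)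
  note less = orbit_dist_less_iff[OF D] and in_Q = mclass_in_mquot[of _ M D]
  have nonneg: "0 \<le> orbit_dist M D x y" if "x \<in> M" "y \<in> M" for x y
    using less[OF that, of 0] nonneg by (meson not_less)
  have sym: "orbit_dist M D y x \<le> orbit_dist M D x y" if M: "x \<in> M" "y \<in> M" for x y
  proof (rule dense_ge)
    fix e assume "orbit_dist M D x y < e"
    then obtain g where g: "g \<in> Iso ?Q ?q" "?q (g (?c x)) (?c y) < e" using less M by blast
    obtain h where h: "h \<in> Iso ?Q ?q" "\<forall>A\<in>?Q. h (g A) = A"
      "\<forall>A\<in>?Q. g (h A) = A"
      using g(1) by (rule Iso_inv)
    have "?q (h (?c y)) (?c x) = ?q (g (?c x)) (?c y)"
      using IsoD(2)[OF h(1), of "?c y" "g (?c x)"] h(2) IsoD(1)[OF g(1)] M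
      by (simp add: commute in_Q)
    with g(2) have "?q (h (?c y)) (?c x) < e" by simp
    then have "orbit_dist M D y x < e" using less[OF M(2,1)] h(1) by blast
    then show "orbit_dist M D y x \<le> e" by simp
  qed
  have tri: "orbit_dist M D x z \<le> max (orbit_dist M D x y) (orbit_dist M D y z)"
    if M: "x \<in> M" "y \<in> M" "z \<in> M" for x y z
  proof (rule dense_ge)
    fix e assume e: "max (orbit_dist M D x y) (orbit_dist M D y z) < e"
    then obtain g where g: "g \<in> Iso ?Q ?q" "?q (g (?c x)) (?c y) < e" using less M by auto
    from e obtain h where h: "h \<in> Iso ?Q ?q" "?q (h (?c y)) (?c z) < e" using less M by auto
    have "?q (h (g (?c x))) (h (?c y)) < e"
      using IsoD(2)[OF h(1), of "g (?c x)" "?c y"] IsoD(1)[OF g(1)] g(2) M in_Q by simp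
    then have "?q (h (g (?c x))) (?c z) < e"
      using pseudo_ultrametric_less_trans[OF pseudo_ultrametric_if_ultrametric_space[OF us]]
        h(2) IsoD(1)[OF g(1)] IsoD(1)[OF h(1)] M in_Q by meson
    then have "orbit_dist M D x z < e"
      using less[OF M(1,3)] M in_Q by (auto intro!: bexI[OF _ Iso_comp[OF h(1) g(1)]])
    then show "orbit_dist M D x z \<le> e" by simp
  qed
  have "orbit_dist M D x x = 0" if "x \<in> M" for x
    using orbit_dist_le[OF D that that] nonneg[OF that that] pseudo_ultrametricD(2)[OF D that] by simp
  then show ?thesis
    unfolding pseudo_ultrametric_def using nonneg sym tri by (meson order_antisym)
qed

lemma rigid_if_orbit_dist_eq:
  assumes D: "pseudo_ultrametric M D"
    and eq: "\<And>x y. x \<in> M \<Longrightarrow> y \<in> M \<Longrightarrow> orbit_dist M D x y = D x y"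
  shows "rigid (mquot M D) (mquot_dist M D)"
proof -
  have "g = (\<lambda>A\<in>mquot M D. A)" if g: "g \<in> Iso (mquot M D) (mquot_dist M D)" for g
  proof (rule extensionalityI[of _ "mquot M D"])
    show "g \<in> extensional (mquot M D)" using g by (simp add: Iso_def)
    fix A assume A: "A \<in> mquot M D"
    then obtain x where x: "x \<in> M" "A = mclass M D x" by (rule mquotE)
    obtain y where y: "y \<in> M" "g A = mclass M D y" using IsoD(1)[OF g A] by (rule mquotE)
    \<comment> \<open>The isometry \<open>g\<close> itself witnesses the bound on the orbit
      distance: it takes the class of \<open>x\<close> to that of \<open>y\<close>, and
      \<open>D y y = 0\<close>. By hypothesis the orbit distance is \<open>D x y\<close>.\<close>
    have "D x y < e" if "e > 0" for e
      using orbit_dist_less_iff[OF D x(1) y(1), of e] g x y that eq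
        mquot_dist_mclass[OF D y(1) y(1)] pseudo_ultrametricD(2)[OF D y(1)] by force
    \<comment> \<open>If \<open>D x y\<close> were positive, the choice \<open>e = D x y\<close>
      would give \<open>D x y < D x y\<close>.\<close>
    from this[of "D x y"] have "D x y = 0" using pseudo_ultrametricD(1)[OF D x(1) y(1)] by linarith
    then show "g A = (\<lambda>A\<in>mquot M D. A) A" using A x y mclass_eq_iff[OF D x(1) y(1)] by simp
  qed simp
  then show ?thesis unfolding rigid_def using Iso_id by blast
qed

section \<open>Quotients with the lifting property\<close>

text \<open>The last clause says that the projection to the quotient by \<open>D\<close> is a submetry; together
  with the one before it, \<open>D x y\<close> is the \<open>d\<close>-distance from \<open>y\<close> to the class of \<open>x\<close>.\<close>

definition covered_by :: "'a set \<Rightarrow> ('a \<Rightarrow> 'a \<Rightarrow> real) \<Rightarrow> ('a \<Rightarrow> 'a \<Rightarrow> real) \<Rightarrow> bool" where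
  "covered_by M d D \<longleftrightarrow> pseudo_ultrametric M D \<and> (\<forall>x\<in>M. \<forall>y\<in>M. D x y \<le> d x y) \<and>
     (\<forall>x\<in>M. \<forall>y\<in>M. \<forall>e. D x y < e \<longrightarrow> (\<exists>x'\<in>mclass M D x. d x' y < e))"

lemma covered_byD:
  assumes "covered_by M d D"
  shows "pseudo_ultrametric M D"
    and "x \<in> M \<Longrightarrow> y \<in> M \<Longrightarrow> D x y \<le> d x y"
  using assms unfolding covered_by_def by blast+

lemma covered_by_lift:
  assumes "covered_by M d D" "x \<in> M" "y \<in> M" "D x y < e"
  obtains x' where "x' \<in> M" "D x x' = 0" "d x' y < e"
  using assms unfolding covered_by_def mclass_def by blast

lemma covered_by_refl:
  assumes "pseudo_ultrametric M d"
  shows "covered_by M d d"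
  using assms mclass_self[OF assms] unfolding covered_by_def by blast

text \<open>An isometry \<open>g\<close> witnessing the small orbit distance takes the class of
  \<open>x\<close> to a class, represented by \<open>z\<close>, near that of \<open>y\<close>.
  Lifting for \<open>D\<close> replaces \<open>z\<close> by a point \<open>x'\<close> of the same
  class that is \<open>d\<close>-close to \<open>y\<close>. The same \<open>g\<close> takes the
  class of \<open>x\<close> to that of \<open>x'\<close>, so these two classes share an
  orbit.\<close>

lemma covered_by_orbit_dist:
  assumes D: "covered_by M d D"
  shows "covered_by M d (orbit_dist M D)"
proof -
  note ps = covered_byD(1)[OF D]
  have "\<exists>x'\<in>mclass M (orbit_dist M D) x. d x' y < e"
    if M: "x \<in> M" "y \<in> M" and e: "orbit_dist M D x y < e" for x y e
  proof -
    obtain g where g: "g \<in> Iso (mquot M D) (mquot_dist M D)"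
      "mquot_dist M D (g (mclass M D x)) (mclass M D y) < e"
      using e unfolding orbit_dist_less_iff[OF ps M] by blast
    obtain z where z: "z \<in> M" "g (mclass M D x) = mclass M D z"
      using IsoD(1)[OF g(1) mclass_in_mquot[OF M(1)]] by (rule mquotE)
    with g(2) have "D z y < e" using mquot_dist_mclass[OF ps] M by simp
    from covered_by_lift[OF D z(1) M(2) this]
    obtain x' where x': "x' \<in> M" "D z x' = 0" "d x' y < e" .
    have "orbit_dist M D x x' < t" if "t > 0" for t
      unfolding orbit_dist_less_iff[OF ps M(1) x'(1)]
      using g(1) z x' that mquot_dist_mclass[OF ps z(1) x'(1)] by (intro bexI[of _ g]) auto
    from this[of "orbit_dist M D x x'"] have "orbit_dist M D x x' = 0"
      using pseudo_ultrametricD(1)[OF pseudo_ultrametric_orbit_dist[OF ps] M(1) x'(1)] by linarith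
    with x' show ?thesis by (auto simp: mclass_def)
  qed
  moreover have "orbit_dist M D x y \<le> d x y" if "x \<in> M" "y \<in> M" for x y
    using orbit_dist_le[OF ps that] covered_byD(2)[OF D that] by simp
  ultimately show ?thesis
    unfolding covered_by_def using pseudo_ultrametric_orbit_dist[OF ps] by blast
qed

lemma mcomplete_mquot:
  assumes us: "ultrametric_space M d" and compl: "Metric_space.mcomplete M d"
    and D: "covered_by M d D"
  shows "Metric_space.mcomplete (mquot M D) (mquot_dist M D)"
proof -
  let ?Q = "mquot M D" and ?q = "mquot_dist M D" and ?c = "mclass M D"
  note ps = covered_byD(1)[OF D] and dps = pseudo_ultrametric_if_ultrametric_space[OF us]
  interpret M: Metric_space M d using us by (simp add: ultrametric_space_def)
  interpret Q: Metric_space ?Q ?q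
    using ultrametric_space_mquot[OF ps] by (simp add: ultrametric_space_def)
  have "\<exists>A. limitin Q.mtopology s A sequentially" if s: "Q.MCauchy s" for s
  proof -
    have "\<forall>n. \<exists>x. x \<in> M \<and> s n = ?c x"
      using s unfolding Q.MCauchy_def by (meson mquotE range_subsetD)
    then obtain x where x: "\<And>n. x n \<in> M" "\<And>n. s n = ?c (x n)" by metis
    have Cauchy: "\<exists>N. \<forall>i\<ge>N. \<forall>j\<ge>N. D (x i) (x j) < e" if e: "e > 0" for e
    proof -
      obtain N where "\<forall>i j. N \<le> i \<longrightarrow> N \<le> j \<longrightarrow> ?q (s i) (s j) < e"
        using s e unfolding Q.MCauchy_def by blast
      then show ?thesis using x mquot_dist_mclass[OF ps] by auto
    qed
    \<comment> \<open>Beyond index \<open>k n\<close> all terms are within \<open>(1/2)^n\<close> of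
      each other. Strict growth of \<open>k\<close> makes the selected terms a subsequence of
      \<open>s\<close>.\<close>
    have "\<exists>k. \<forall>n. (\<forall>i\<ge>k n. \<forall>j\<ge>k n. D (x i) (x j) < (1/2)^n) \<and> k n < k (Suc n)"
    proof (rule dependent_nat_choice)
      show "\<exists>m. \<forall>i\<ge>m. \<forall>j\<ge>m. D (x i) (x j) < (1/2)^0" by (rule Cauchy) simp
    next
      fix m n :: nat
      obtain N where "\<forall>i\<ge>N. \<forall>j\<ge>N. D (x i) (x j) < (1/2)^(Suc n)"
        using Cauchy[of "(1/2)^(Suc n)"] by auto
      then show "\<exists>m'. (\<forall>i\<ge>m'. \<forall>j\<ge>m'. D (x i) (x j) < (1/2)^(Suc n)) \<and> m < m'"
        by (intro exI[of _ "max N (Suc m)"]) auto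
    qed
    then obtain k where k: "\<And>n i j. k n \<le> i \<Longrightarrow> k n \<le> j \<Longrightarrow> D (x i) (x j) < (1/2)^n"
      and k_less: "\<And>n. k n < k (Suc n)" by metis
    \<comment> \<open>Representatives are chosen one after the other: \<open>y (Suc n)\<close> is a
      lift of the class with index \<open>k (Suc n)\<close>, taken close to the representative
      \<open>y n\<close> already fixed.\<close>
    have "\<exists>y. \<forall>n. (y n \<in> M \<and> D (x (k n)) (y n) = 0) \<and> d (y (Suc n)) (y n) < (1/2)^n"
    proof (rule dependent_nat_choice)
      show "\<exists>z. z \<in> M \<and> D (x (k 0)) z = 0" using x pseudo_ultrametricD(2)[OF ps] by blast
    next
      fix z n assume z: "z \<in> M \<and> D (x (k n)) z = 0"
      have "D (x (k (Suc n))) z < (1/2)^n"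
        using z k[of n "k (Suc n)" "k n"] k_less[of n]
          pseudo_ultrametric_less_trans[OF ps x(1) x(1), of z "k (Suc n)" "k n" "(1/2)^n"] by simp
      with z x(1) obtain z' where "z' \<in> M" "D (x (k (Suc n))) z' = 0" "d z' z < (1/2)^n"
        using covered_by_lift[OF D] by blast
      then show "\<exists>z'. (z' \<in> M \<and> D (x (k (Suc n))) z' = 0) \<and> d z' z < (1/2)^n" by blast
    qed
    then obtain y where y: "\<And>n. y n \<in> M" "\<And>n. D (x (k n)) (y n) = 0"
      "\<And>n. d (y (Suc n)) (y n) < (1/2)^n" by metis
    \<comment> \<open>The ultrametric inequality bounds a chain of steps by its largest step, so the
      bound does not grow with \<open>m\<close> and no geometric series has to be summed.\<close>
    have dist_y: "d (y (n + m)) (y n) < (1/2)^n" for n m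
    proof (induction m)
      case (Suc m)
      have "(1/2::real)^(n + m) \<le> (1/2)^n" by (rule power_decreasing) auto
      then have "d (y (Suc (n + m))) (y (n + m)) < (1/2)^n" using y(3)[of "n + m"] by linarith
      with Suc show ?case
        using pseudo_ultrametric_less_trans[OF dps y(1) y(1) y(1), of "Suc (n + m)" "n + m" _ n]
        by simp
    qed (use y in auto)
    have "M.MCauchy y"
      unfolding M.MCauchy_def
    proof (intro conjI allI impI)
      fix e :: real assume "e > 0"
      then obtain N where N: "(1/2)^N < e" using real_arch_pow_inv[of e "1/2"] by auto
      have "d (y i) (y N) < e" if "N \<le> i" for i
        using dist_y[of N "i - N"] that N by simp
      then have "d (y i) (y j) < e" if "N \<le> i" "N \<le> j" for i j
        using that pseudo_ultrametric_less_trans[OF dps, of "y i" "y N" "y j"] y(1)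
          M.commute[of "y N" "y j"] by simp
      then show "\<exists>N. \<forall>i j. N \<le> i \<longrightarrow> N \<le> j \<longrightarrow> d (y i) (y j) < e" by blast
    qed (use y in auto)
    then obtain l where l: "limitin M.mtopology y l sequentially"
      using compl unfolding M.mcomplete_def by blast
    then have lM: "l \<in> M" by (simp add: M.limit_metric_sequentially)
    \<comment> \<open>The limit survives projection because \<open>D\<close> is bounded by
      \<open>d\<close>. Convergence along \<open>k\<close> is enough, since a Cauchy sequence with a
      convergent subsequence converges.\<close>
    have "limitin Q.mtopology (s \<circ> k) (?c l) sequentially"
      unfolding Q.limit_metric_sequentially
    proof (intro conjI allI impI)
      show "?c l \<in> ?Q" using lM by (rule mclass_in_mquot)
      fix e :: real assume "e > 0"
      then obtain N where N: "\<forall>n\<ge>N. d (y n) l < e"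
        using l unfolding M.limit_metric_sequentially by blast
      have "?q (s (k n)) (?c l) < e" if "n \<ge> N" for n
      proof -
        have "?q (s (k n)) (?c l) = D (x (k n)) l"
          using x lM mquot_dist_mclass[OF ps] by simp
        also have "\<dots> = D (y n) l"
          using pseudo_ultrametric_cong_zero[OF ps x(1) y(1) lM y(2)] by simp
        also have "\<dots> \<le> d (y n) l" using covered_byD(2)[OF D y(1) lM] .
        finally show ?thesis using N that by fastforce
      qed
      then show "\<exists>N. \<forall>n\<ge>N. (s \<circ> k) n \<in> ?Q \<and> ?q ((s \<circ> k) n) (?c l) < e"
        using x by (auto simp: mclass_in_mquot)
    qed
    moreover have "strict_mono k" using k_less by (simp add: strict_mono_Suc_iff)
    ultimately show ?thesis using Q.MCauchy_convergent_subsequence[OF s] by blast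
  qed
  then show ?thesis unfolding Q.mcomplete_def by blast
qed

text \<open>This epsilon form of density serves twice: to push a dense set to a quotient, and to
  compare pseudo-ultrametrics on countably many points.\<close>

lemma (in Metric_space) separable_space_mtopology_iff:
  "separable_space mtopology \<longleftrightarrow>
    (\<exists>C. countable C \<and> C \<subseteq> M \<and> (\<forall>x\<in>M. \<forall>e>0. \<exists>c\<in>C. d x c < e))"
proof -
  have "mtopology closure_of C = M \<longleftrightarrow> (\<forall>x\<in>M. \<forall>e>0. \<exists>c\<in>C. d x c < e)" if "C \<subseteq> M" for C
    using that unfolding metric_closure_of by (auto simp: subset_iff)
  then show ?thesis unfolding separable_space_def topspace_mtopology by meson
qed

text \<open>Completeness comes from lifting. Separability holds because the projection is
  1-Lipschitz, so the image of a countable dense set is again countable and dense.\<close>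

lemma Polish_ultrametric_space_mquot:
  assumes P: "Polish_ultrametric_space M d" and D: "covered_by M d D"
  shows "Polish_ultrametric_space (mquot M D) (mquot_dist M D)"
proof -
  note ps = covered_byD(1)[OF D]
  have us: "ultrametric_space M d" using P by (simp add: Polish_ultrametric_space_def)
  interpret M: Metric_space M d using us by (simp add: ultrametric_space_def)
  interpret Q: Metric_space "mquot M D" "mquot_dist M D"
    using ultrametric_space_mquot[OF ps] by (simp add: ultrametric_space_def)
  obtain C where C: "countable C" "C \<subseteq> M" "\<forall>x\<in>M. \<forall>e>0. \<exists>c\<in>C. d x c < e"
    using P unfolding Polish_ultrametric_space_def M.separable_space_mtopology_iff by metis
  have "separable_space Q.mtopology"
    unfolding Q.separable_space_mtopology_iff
  proof (intro exI[of _ "mclass M D ` C"] conjI ballI allI impI)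
    show "countable (mclass M D ` C)" using C by simp
    show "mclass M D ` C \<subseteq> mquot M D" using C unfolding mquot_def by blast
    fix A and e :: real assume "A \<in> mquot M D" "e > 0"
    then obtain x c where x: "x \<in> M" "A = mclass M D x" and c: "c \<in> C" "d x c < e"
      using C(3) by (metis mquotE)
    have "mquot_dist M D A (mclass M D c) < e"
      using x c C(2) covered_byD(2)[OF D x(1), of c] mquot_dist_mclass[OF ps x(1), of c] by auto
    with c show "\<exists>B\<in>mclass M D ` C. mquot_dist M D A B < e" by blast
  qed
  then show ?thesis
    using P mcomplete_mquot[OF us _ D] ultrametric_space_mquot[OF ps]
    unfolding Polish_ultrametric_space_def by blast
qed

text \<open>Every strict bound on the infimum holds at some single index. Directedness brings the
  two bounds of the triangle inequality to a common index. For lifting, one index suffices, because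
  distance zero for \<open>D i\<close> forces distance zero for the infimum.\<close>

lemma covered_by_INF:
  assumes I: "I \<noteq> {}" and cov: "\<And>i. i \<in> I \<Longrightarrow> covered_by M d (D i)"
    and dir: "\<And>i j. i \<in> I \<Longrightarrow> j \<in> I \<Longrightarrow>
      \<exists>k\<in>I. \<forall>x\<in>M. \<forall>y\<in>M. D k x y \<le> D i x y \<and> D k x y \<le> D j x y"
  shows "covered_by M d (\<lambda>x y. INF i\<in>I. D i x y)"
    and "\<And>i x y. i \<in> I \<Longrightarrow> x \<in> M \<Longrightarrow> y \<in> M \<Longrightarrow> (INF i\<in>I. D i x y) \<le> D i x y"
proof -
  let ?L = "\<lambda>x y. INF i\<in>I. D i x y"
  note ps = covered_byD(1)[OF cov]
  have bdd: "bdd_below ((\<lambda>i. D i x y) ` I)" if "x \<in> M" "y \<in> M" for x y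
    using that pseudo_ultrametricD(1)[OF ps] by (intro bdd_belowI2[of _ 0]) auto
  have less: "?L x y < e \<longleftrightarrow> (\<exists>i\<in>I. D i x y < e)" if "x \<in> M" "y \<in> M" for x y e
    by (rule cINF_less_iff[OF I bdd[OF that]])
  show le: "?L x y \<le> D i x y" if "i \<in> I" "x \<in> M" "y \<in> M" for i x y
    using that by (intro cINF_lower bdd)
  have nonneg: "0 \<le> ?L x y" if "x \<in> M" "y \<in> M" for x y
    using that pseudo_ultrametricD(1)[OF ps] by (intro cINF_greatest I) auto
  obtain i0 where i0: "i0 \<in> I" using I by blast
  have refl: "?L x x = 0" if "x \<in> M" for x
    using le[OF i0 that that] nonneg[OF that that] pseudo_ultrametricD(2)[OF ps[OF i0] that]
    by linarith
  have sym: "?L x y = ?L y x" if "x \<in> M" "y \<in> M" for x y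
    using that pseudo_ultrametricD(3)[OF ps] by (intro INF_cong) auto
  have tri: "?L x z \<le> max (?L x y) (?L y z)" if M: "x \<in> M" "y \<in> M" "z \<in> M" for x y z
  proof (rule dense_ge)
    fix e assume "max (?L x y) (?L y z) < e"
    then have "?L x y < e" "?L y z < e" by auto
    then obtain i j where i: "i \<in> I" "D i x y < e" and j: "j \<in> I" "D j y z < e"
      using less M by meson
    obtain k where k: "k \<in> I" "\<forall>x\<in>M. \<forall>y\<in>M. D k x y \<le> D i x y \<and> D k x y \<le> D j x y"
      using dir[OF i(1) j(1)] by blast
    have "D k x y < e" "D k y z < e" using k(2) i(2) j(2) M by (meson le_less_trans)+
    then have "D k x z < e" by (rule pseudo_ultrametric_less_trans[OF ps[OF k(1)] M])
    then show "?L x z \<le> e" using le[OF k(1) M(1,3)] by linarith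
  qed
  have "pseudo_ultrametric M ?L"
    unfolding pseudo_ultrametric_def by (intro conjI ballI nonneg refl sym tri)
  moreover have "\<exists>x'\<in>mclass M ?L x. d x' y < e" if M: "x \<in> M" "y \<in> M" and e: "?L x y < e" for x y e
  proof -
    obtain i where i: "i \<in> I" "D i x y < e" using e less[OF M] by blast
    obtain x' where x': "x' \<in> M" "D i x x' = 0" "d x' y < e"
      using covered_by_lift[OF cov[OF i(1)] M i(2)] .
    have "?L x x' = 0" using le[OF i(1) M(1) x'(1)] nonneg[OF M(1) x'(1)] x'(2) by linarith
    with x' show ?thesis by (auto simp: mclass_def)
  qed
  moreover have "?L x y \<le> d x y" if "x \<in> M" "y \<in> M" for x y
    using le[OF i0 that] covered_byD(2)[OF cov[OF i0] that] by linarith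
  ultimately show "covered_by M d ?L"
    unfolding covered_by_def by (intro conjI ballI allI impI)
qed

text \<open>If \<open>L x y = 0\<close>, then for every \<open>e\<close> some \<open>D i x y\<close>
  is below \<open>e\<close>, and lifting at \<open>i\<close> puts a point of the
  \<open>D i\<close>-class of \<open>x\<close> within \<open>e\<close> of \<open>y\<close>.
  Conversely, a point \<open>z\<close> of such a class near \<open>y\<close> has
  \<open>L x z\<close> zero and \<open>L z y\<close> at most \<open>d z y\<close>.\<close>

lemma mclass_eq_closure_of_Union:
  assumes us: "ultrametric_space M d" and cov: "covered_by M d L"
    and le: "\<And>i x y. i \<in> I \<Longrightarrow> x \<in> M \<Longrightarrow> y \<in> M \<Longrightarrow> L x y \<le> D i x y"
    and D: "\<And>i. i \<in> I \<Longrightarrow> covered_by M d (D i)"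
    and approx: "\<And>y e. y \<in> M \<Longrightarrow> L x y < e \<Longrightarrow> \<exists>i\<in>I. D i x y < e"
    and x: "x \<in> M"
  shows "mclass M L x = Metric_space.mtopology M d closure_of (\<Union>i\<in>I. mclass M (D i) x)"
proof -
  interpret Metric_space M d using us by (simp add: ultrametric_space_def)
  note ps = covered_byD(1)[OF cov]
  have "L x y = 0 \<longleftrightarrow> (\<forall>e>0. \<exists>z\<in>(\<Union>i\<in>I. mclass M (D i) x). z \<in> mball y e)" if y: "y \<in> M" for y
  proof safe
    fix e :: real assume e: "L x y = 0" "e > 0"
    then obtain i where i: "i \<in> I" "D i x y < e" using approx[OF y, of e] by auto
    obtain z where z: "z \<in> M" "D i x z = 0" "d z y < e"
      using covered_by_lift[OF D[OF i(1)] x y i(2)] .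
    then have "z \<in> mclass M (D i) x" "z \<in> mball y e"
      using y commute[of z y] by (auto simp: mclass_def)
    with i(1) show "\<exists>z\<in>(\<Union>i\<in>I. mclass M (D i) x). z \<in> mball y e" by blast
  next
    assume close: "\<forall>e>0. \<exists>z\<in>(\<Union>i\<in>I. mclass M (D i) x). z \<in> mball y e"
    have "L x y < e" if "e > 0" for e
    proof -
      from close \<open>e > 0\<close> obtain i z
        where z: "i \<in> I" "z \<in> M" "D i x z = 0" "d y z < e" by (auto simp: mclass_def)
      have "L x z < e" using le[OF z(1) x z(2)] z(3) \<open>e > 0\<close> by linarith
      moreover have "L z y < e" using covered_byD(2)[OF cov z(2) y] z(4) commute[of z y] by linarith
      ultimately show ?thesis by (rule pseudo_ultrametric_less_trans[OF ps x z(2) y])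
    qed
    from this[of "L x y"] show "L x y = 0" using pseudo_ultrametricD(1)[OF ps x y] by linarith
  qed
  then show ?thesis unfolding metric_closure_of mclass_def by auto
qed

section \<open>The transfinite sequence\<close>

lemma dseq_covered:
  assumes us: "ultrametric_space X d" and r: "Well_order r" and a: "a \<in> Field r"
  shows "covered_by X d (dseq X d r a)" (is "?cov a")
    and "\<And>b x y. b \<in> underS r a \<Longrightarrow> x \<in> X \<Longrightarrow> y \<in> X \<Longrightarrow> dseq X d r a x y \<le> dseq X d r b x y"
proof -
  interpret wo_rel r using r by (rule wo_rel.intro)
  let ?le = "\<lambda>a b. \<forall>x\<in>X. \<forall>y\<in>X. dseq X d r a x y \<le> dseq X d r b x y"
  \<comment> \<open>Covering and monotonicity are proved in one induction: at a limit, the family of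
    earlier stages is directed because it is monotone.\<close>
  have "a \<in> Field r \<longrightarrow> ?cov a \<and> (\<forall>b\<in>underS a. ?le a b)"
  proof (induction a rule: well_order_induct)
    case (1 a)
    have IH: "?cov b" "\<And>c. c \<in> underS b \<Longrightarrow> ?le b c" if "b \<in> underS a" for b
      using 1 that by (auto simp: underS_def Field_def)
    show ?case
    proof
      assume "a \<in> Field r"
      then consider (z) "underS a = {}" | (s) b where "is_succ r b a" | (l) "is_limit r a"
        unfolding is_limit_def by blast
      then show "?cov a \<and> (\<forall>b\<in>underS a. ?le a b)"
      proof cases
        case z
        then show ?thesis
          using covered_by_refl[OF pseudo_ultrametric_if_ultrametric_space[OF us]]
          by (simp add: dseq_zero[OF r])
      next
        case (s b)
        then have b: "b \<in> underS a" and below: "\<And>c. c \<in> underS a \<Longrightarrow> c = b \<or> c \<in> underS b"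
          unfolding is_succ_def underS_def by blast+
        have eq: "dseq X d r a = orbit_dist X (dseq X d r b)" by (rule dseq_succ[OF r s])
        have "?le a b"
          unfolding eq using orbit_dist_le[OF covered_byD(1)[OF IH(1)[OF b]]] by blast
        then have "?le a c" if "c \<in> underS a" for c
          using below[OF that] IH(2)[OF b] by (meson order_trans)
        with covered_by_orbit_dist[OF IH(1)[OF b]] show ?thesis unfolding eq by blast
      next
        case l
        have eq: "dseq X d r a = (\<lambda>x y. INF b\<in>underS a. dseq X d r b x y)"
          using dseq_limit[OF r l] by (intro ext)
        have ne: "underS a \<noteq> {}" using l unfolding is_limit_def by blast
        have dir: "\<exists>k\<in>underS a. \<forall>x\<in>X. \<forall>y\<in>X.
            dseq X d r k x y \<le> dseq X d r b x y \<and> dseq X d r k x y \<le> dseq X d r c x y"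
          if b: "b \<in> underS a" and c: "c \<in> underS a" for b c
        proof -
          \<comment> \<open>Stages are linearly ordered, so the later of the two is a lower bound
            for both.\<close>
          have "b = c \<or> b \<in> underS c \<or> c \<in> underS b"
            using b c TOTALS unfolding underS_def Field_def by blast
          then show ?thesis using IH(2)[OF b] IH(2)[OF c] b c by (metis order_refl)
        qed
        show ?thesis
          unfolding eq using covered_by_INF[OF ne IH(1) dir] by blast
      qed
    qed
  qed
  with a show "?cov a"
    and "\<And>b x y. b \<in> underS a \<Longrightarrow> x \<in> X \<Longrightarrow> y \<in> X \<Longrightarrow> dseq X d r a x y \<le> dseq X d r b x y"
    by blast+
qed

lemma dseq_limit_less_iff:
  assumes us: "ultrametric_space X d" and r: "Well_order r" and l: "is_limit r a"
    and xy: "x \<in> X" "y \<in> X"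
  shows "dseq X d r a x y < e \<longleftrightarrow> (\<exists>b\<in>underS r a. dseq X d r b x y < e)"
  unfolding dseq_limit[OF r l]
proof (rule cINF_less_iff)
  show "underS r a \<noteq> {}" using l unfolding is_limit_def by blast
  have "0 \<le> dseq X d r b x y" if "b \<in> underS r a" for b
    using that pseudo_ultrametricD(1)[OF covered_byD(1)[OF dseq_covered(1)[OF us r]] xy]
      underS_Field by fastforce
  then show "bdd_below ((\<lambda>b. dseq X d r b x y) ` underS r a)" by (intro bdd_belowI2[of _ 0])
qed

section \<open>Stabilization at a countable ordinal\<close>

lemma Card_order_omega_1: "Card_order omega_1"
  unfolding omega_1_def by (rule cardSuc_Card_order[OF natLeq_Card_order])

lemma Well_order_omega_1: "Well_order omega_1"
  using Card_order_omega_1 by (simp add: card_order_on_def)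

lemma uncountable_Field_omega_1:
  includes cardinal_syntax
  shows "uncountable (Field omega_1)"
proof
  assume "countable (Field omega_1)"
  then have "|Field omega_1| \<le>o natLeq"
    unfolding countable_card_le_natLeq .
  moreover have "natLeq <o |Field omega_1|"
    using cardSuc_greater[OF natLeq_Card_order] card_of_Field_ordIso[OF Card_order_omega_1]
    unfolding omega_1_def using ordIso_symmetric ordLess_ordIso_trans by blast
  ultimately show False using not_ordLess_ordLeq by blast
qed

text \<open>Proper initial segments of a cardinal order have smaller cardinality than the whole, and
  what lies strictly below the successor of \<open>natLeq\<close> is at most
  \<open>natLeq\<close>.\<close>

lemma countable_underS_omega_1:
  includes cardinal_syntax
  assumes "a \<in> Field omega_1"
  shows "countable (underS omega_1 a)"
proof -
  have "|underS omega_1 a| <o cardSuc natLeq"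
    using card_of_underS[OF Card_order_omega_1 assms] unfolding omega_1_def .
  then show ?thesis
    using cardSuc_ordLeq_ordLess[OF natLeq_Card_order card_of_Card_order]
    unfolding countable_card_le_natLeq by blast
qed

text \<open>A countable union of countable initial segments cannot exhaust the uncountable field,
  and any element outside the union is a strict upper bound. This is the uncountable cofinality of
  \<open>omega_1\<close>.\<close>

lemma countable_bounded_in_omega_1:
  assumes "countable A" "A \<subseteq> Field omega_1"
  obtains s where "s \<in> Field omega_1" "A \<subseteq> underS omega_1 s"
proof -
  interpret wo_rel omega_1 using Well_order_omega_1 by (rule wo_rel.intro)
  have "countable (\<Union>a\<in>A. insert a (underS a))"
    using assms countable_underS_omega_1 by (intro countable_UN) auto
  then have "\<not> Field omega_1 \<subseteq> (\<Union>a\<in>A. insert a (underS a))"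
    using uncountable_Field_omega_1 countable_subset by metis
  then obtain s where s: "s \<in> Field omega_1" "s \<notin> (\<Union>a\<in>A. insert a (underS a))" by blast
  then have "A \<subseteq> underS s" using assms(2) TOTALS unfolding underS_def by blast
  with s(1) show thesis by (rule that)
qed

text \<open>Since something lies strictly above \<open>b\<close>, the least strict upper bound
  \<open>suc {b}\<close> exists. An element below it but not below or equal to \<open>b\<close>
  would be a smaller strict upper bound.\<close>

lemma is_succ_exists:
  assumes r: "Well_order r" and "b \<in> underS r a"
  obtains s where "s \<in> Field r" "is_succ r b s"
proof -
  interpret wo_rel r using r by (rule wo_rel.intro)
  have b: "{b} \<subseteq> Field r" and above: "AboveS {b} \<noteq> {}"
    using assms(2) by (auto simp: underS_def AboveS_def Field_def)
  have "b \<in> underS (suc {b})" using suc_greater[OF b above] by (auto simp: underS_def)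
  moreover have "(c, b) \<in> r" if c: "c \<in> underS (suc {b})" for c
  proof (rule ccontr)
    assume cb: "(c, b) \<notin> r"
    have cF: "c \<in> Field r" using c by (auto simp: underS_def Field_def)
    then have "(b, c) \<in> r" "b \<noteq> c" using cb b TOTALS by auto
    then have "c \<in> AboveS {b}" using cF by (auto simp: AboveS_def)
    then have "(suc {b}, c) \<in> r" by (rule suc_least_AboveS)
    then show False using c ANTISYM by (auto simp: underS_def antisym_def)
  qed
  ultimately show thesis
    using that suc_inField[OF b above] unfolding is_succ_def by blast
qed

lemma dseq_stabilizes:
  assumes P: "Polish_ultrametric_space X d"
  obtains s where "s \<in> Field omega_1"
    and "\<forall>a. s \<in> underS omega_1 a \<longrightarrow>
      (\<forall>x\<in>X. \<forall>y\<in>X. dseq X d omega_1 a x y = dseq X d omega_1 s x y)"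
proof -
  let ?D = "dseq X d omega_1" and ?F = "Field omega_1"
  have us: "ultrametric_space X d" using P by (simp add: Polish_ultrametric_space_def)
  interpret Metric_space X d using us by (simp add: ultrametric_space_def)
  note cov = dseq_covered[OF us Well_order_omega_1]
  note ps = covered_byD(1)[OF cov(1)]
  obtain C where C: "countable C" "C \<subseteq> X" "\<forall>x\<in>X. \<forall>e>0. \<exists>c\<in>C. d x c < e"
    using P unfolding Polish_ultrametric_space_def separable_space_mtopology_iff by metis
  \<comment> \<open>For points \<open>x\<close>, \<open>y\<close> and a rational \<open>q\<close>,
    this selects a stage at which the distance has dropped below \<open>q\<close>, provided there is
    one; \<open>?T\<close> collects the triples for which there is.\<close>
  define B where "B = (\<lambda>(x, y, q). SOME a. a \<in> ?F \<and> ?D a x y < q)"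
  let ?T = "{(x, y, q) \<in> C \<times> C \<times> \<rat>. \<exists>a\<in>?F. ?D a x y < q}"
  have B: "B (x, y, q) \<in> ?F \<and> ?D (B (x, y, q)) x y < q" if "a \<in> ?F" "?D a x y < q" for a x y q
    unfolding B_def prod.case by (rule someI[of _ a]) (use that in blast)
  have "countable (C \<times> C \<times> (\<rat> :: real set))"
    using C(1) countable_rat by (intro countable_SIGMA)
  then have "countable ?T" by (rule countable_subset[rotated]) auto
  moreover have "B ` ?T \<subseteq> ?F" using B by auto
  ultimately obtain s where s: "s \<in> ?F" "B ` ?T \<subseteq> underS omega_1 s"
    by (rule countable_bounded_in_omega_1[OF countable_image])
  \<comment> \<open>If the distance dropped further at \<open>a\<close>, a rational \<open>q\<close>
    would fit between the two values. The stage \<open>B (x, y, q)\<close> selected for it lies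
    before \<open>s\<close>, so by monotonicity the value at \<open>s\<close> would already be below
    \<open>q\<close>.\<close>
  have stable_C: "?D s x y \<le> ?D a x y" if a: "a \<in> ?F" and xy: "x \<in> C" "y \<in> C" for a x y
  proof (rule ccontr)
    assume "\<not> ?D s x y \<le> ?D a x y"
    then obtain q where q: "q \<in> \<rat>" "?D a x y < q" "q < ?D s x y"
      using Rats_dense_in_real[of "?D a x y" "?D s x y"] by auto
    then have "(x, y, q) \<in> ?T" using a xy by blast
    then have "B (x, y, q) \<in> underS omega_1 s" using s(2) by blast
    then have "?D s x y \<le> ?D (B (x, y, q)) x y" using cov(2)[OF s(1)] xy C(2) by blast
    with B[OF a q(2)] q(3) show False by linarith
  qed
  have "?D a x y = ?D s x y" if a: "s \<in> underS omega_1 a" and xy: "x \<in> X" "y \<in> X" for a x y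
  proof (rule antisym)
    have aF: "a \<in> ?F" using a by (auto simp: underS_def Field_def)
    show "?D a x y \<le> ?D s x y" by (rule cov(2)[OF aF a xy])
    show "?D s x y \<le> ?D a x y"
    proof (rule dense_ge)
      fix e assume e: "?D a x y < e"
      then have "e > 0" using pseudo_ultrametricD(1)[OF ps[OF aF] xy] by linarith
      then obtain x' y' where x': "x' \<in> C" "d x x' < e" and y': "y' \<in> C" "d y y' < e"
        using C(3) xy by meson
      then have X': "x' \<in> X" "y' \<in> X" using C(2) by auto
      \<comment> \<open>All stages are bounded by \<open>d\<close>, so one pair of approximating
        points serves for both \<open>a\<close> and \<open>s\<close>. The tolerance may equal the
        bound \<open>e\<close> itself, because replacing a point by one less than \<open>e\<close>
        away preserves being below \<open>e\<close> in an ultrametric.\<close>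
      have close: "?D b x x' < e" "?D b y' y < e" "?D b x' x < e" "?D b y y' < e" if "b \<in> ?F" for b
        using covered_byD(2)[OF cov(1)[OF that]] xy X' x'(2) y'(2) commute
        by (metis le_less_trans)+
      have "?D a x' y < e"
        by (rule pseudo_ultrametric_less_trans[OF ps[OF aF] X'(1) xy close(3)[OF aF] e])
      then have "?D a x' y' < e"
        by (rule pseudo_ultrametric_less_trans[OF ps[OF aF] X'(1) xy(2) X'(2) _ close(4)[OF aF]])
      then have "?D s x' y' < e" using stable_C[OF aF x'(1) y'(1)] by linarith
      then have "?D s x y' < e"
        by (rule pseudo_ultrametric_less_trans[OF ps[OF s(1)] xy(1) X' close(1)[OF s(1)]])
      then have "?D s x y < e"
        by (rule pseudo_ultrametric_less_trans[OF ps[OF s(1)] xy(1) X'(2) xy(2) _ close(2)[OF s(1)]])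
      then show "?D s x y \<le> e" by simp
    qed
  qed
  with s(1) show thesis by (intro that) blast+
qed

lemma dseq_eventually_rigid:
  assumes P: "Polish_ultrametric_space X d"
  shows "\<exists>s\<in>Field omega_1. \<exists>t. is_succ omega_1 s t \<and>
    (\<forall>x\<in>X. \<forall>y\<in>X. dseq X d omega_1 t x y = dseq X d omega_1 s x y) \<and>
    rigid (seq_quot X d omega_1 s) (seq_quot_dist X d omega_1 s)"
proof -
  have us: "ultrametric_space X d" using P by (simp add: Polish_ultrametric_space_def)
  obtain s where s: "s \<in> Field omega_1"
    and stable: "\<forall>a. s \<in> underS omega_1 a \<longrightarrow>
      (\<forall>x\<in>X. \<forall>y\<in>X. dseq X d omega_1 a x y = dseq X d omega_1 s x y)"
    using dseq_stabilizes[OF P] .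
  \<comment> \<open>Boundedness of the countable set \<open>{s}\<close> shows that \<open>s\<close>
    is not the last element of \<open>omega_1\<close>, so its successor \<open>t\<close> is
    available there. The distance at \<open>t\<close> is the orbit distance of the one at
    \<open>s\<close>, and their equality gives rigidity.\<close>
  have "countable {s}" "{s} \<subseteq> Field omega_1" using s by auto
  then obtain u where "u \<in> Field omega_1" "{s} \<subseteq> underS omega_1 u"
    by (rule countable_bounded_in_omega_1)
  then have "s \<in> underS omega_1 u" by blast
  with Well_order_omega_1 obtain t where "t \<in> Field omega_1" and t: "is_succ omega_1 s t"
    by (rule is_succ_exists)
  then have eq: "dseq X d omega_1 t x y = dseq X d omega_1 s x y" if "x \<in> X" "y \<in> X" for x y
    using stable that unfolding is_succ_def by blast
  have "rigid (seq_quot X d omega_1 s) (seq_quot_dist X d omega_1 s)"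
    using eq unfolding dseq_succ[OF Well_order_omega_1 t]
    by (rule rigid_if_orbit_dist_eq[OF
          covered_byD(1)[OF dseq_covered(1)[OF us Well_order_omega_1 s]]])
  with s t eq show ?thesis by blast
qed

section \<open>The direct limit\<close>

text \<open>Distances decrease along the sequence, so a class at stage \<open>b\<close> lies inside
  a single class at stage \<open>a\<close>. Together with nonemptiness this makes the definite
  description in \<open>seq_proj\<close> unique.\<close>

lemma seq_proj_class:
  assumes us: "ultrametric_space X d" and r: "Well_order r" and a: "a \<in> Field r"
    and b: "b \<in> underS r a" and x: "x \<in> X"
  shows "seq_proj X d r b a (seq_class X d r b x) = seq_class X d r a x"
proof -
  have bF: "b \<in> Field r" using b by (auto simp: underS_def Field_def)
  note ps = covered_byD(1)[OF dseq_covered(1)[OF us r]]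
  have "seq_class X d r a y = seq_class X d r a x" if y: "y \<in> seq_class X d r b x" for y
  proof -
    have yX: "y \<in> X" and "dseq X d r b x y = 0" using y by (auto simp: mclass_def)
    then have "dseq X d r a x y = 0"
      using dseq_covered(2)[OF us r a b x yX] pseudo_ultrametricD(1)[OF ps[OF a] x yX] by simp
    then show ?thesis using mclass_eq_iff[OF ps[OF a] x yX] by simp
  qed
  moreover have "x \<in> seq_class X d r b x" by (rule mclass_self[OF ps[OF bF] x])
  ultimately have "(\<forall>y\<in>seq_class X d r b x. C = seq_class X d r a y) \<longleftrightarrow> C = seq_class X d r a x" for C
    by blast
  then show ?thesis by (simp add: seq_proj_def mclass_in_mquot[OF x])
qed

lemma metric_map_seq_proj:
  assumes us: "ultrametric_space X d" and r: "Well_order r" and a: "a \<in> Field r"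
    and b: "b \<in> underS r a"
  shows "metric_map (seq_quot X d r b) (seq_quot_dist X d r b)
    (seq_quot X d r a) (seq_quot_dist X d r a) (seq_proj X d r b a)"
proof -
  have bF: "b \<in> Field r" using b by (auto simp: underS_def Field_def)
  note ps = covered_byD(1)[OF dseq_covered(1)[OF us r]]
  note proj = seq_proj_class[OF us r a b]
  show ?thesis
    unfolding metric_map_def
  proof (intro conjI Pi_I ballI)
    show "seq_proj X d r b a A \<in> seq_quot X d r a" if "A \<in> seq_quot X d r b" for A
      using that by (auto elim!: mquotE simp: proj mclass_in_mquot)
    fix A B assume "A \<in> seq_quot X d r b" "B \<in> seq_quot X d r b"
    then obtain x y where "x \<in> X" "A = seq_class X d r b x" "y \<in> X" "B = seq_class X d r b y"
      by (elim mquotE)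
    then show "seq_quot_dist X d r a (seq_proj X d r b a A) (seq_proj X d r b a B)
        \<le> seq_quot_dist X d r b A B"
      using dseq_covered(2)[OF us r a b]
      by (simp add: proj mquot_dist_mclass[OF ps[OF a]] mquot_dist_mclass[OF ps[OF bF]])
  qed
qed

text \<open>Evaluated on the class of a point, both sides give the class of that same point at stage
  \<open>a\<close>.\<close>

lemma seq_proj_trans:
  assumes us: "ultrametric_space X d" and r: "Well_order r" and a: "a \<in> Field r"
    and b: "b \<in> underS r a" and c: "c \<in> underS r b" and A: "A \<in> seq_quot X d r c"
  shows "seq_proj X d r b a (seq_proj X d r c b A) = seq_proj X d r c a A"
proof -
  have bF: "b \<in> Field r" using b by (auto simp: underS_def Field_def)
  have ca: "c \<in> underS r a"
    using b c wo_rel.TRANS[OF wo_rel.intro[OF r]] wo_rel.ANTISYM[OF wo_rel.intro[OF r]]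
    unfolding underS_def trans_def antisym_def by blast
  show ?thesis
    using A seq_proj_class[OF us r a b] seq_proj_class[OF us r bF c] seq_proj_class[OF us r a ca]
    by (auto elim!: mquotE)
qed

lemma direct_system_seq_quot:
  assumes us: "ultrametric_space X d" and r: "Well_order r"
  shows "direct_system r a (seq_quot X d r) (seq_quot_dist X d r) (seq_proj X d r)"
proof -
  have F: "b \<in> Field r" if "b \<in> underS r a" for b a
    using that by (auto simp: underS_def Field_def)
  have "Metric_space (seq_quot X d r b) (seq_quot_dist X d r b)" if "b \<in> Field r" for b
    using ultrametric_space_mquot[OF covered_byD(1)[OF dseq_covered(1)[OF us r that]]]
    by (simp add: ultrametric_space_def)
  then show ?thesis
    unfolding direct_system_def
    using F metric_map_seq_proj[OF us r] seq_proj_trans[OF us r] by blast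
qed

lemma cocone_seq_quot:
  assumes us: "ultrametric_space X d" and r: "Well_order r" and a: "a \<in> Field r"
  shows "cocone r a (seq_quot X d r) (seq_quot_dist X d r) (seq_proj X d r)
    (seq_quot X d r a) (seq_quot_dist X d r a) (\<lambda>b. seq_proj X d r b a)"
proof -
  have "Metric_space (seq_quot X d r a) (seq_quot_dist X d r a)"
    using ultrametric_space_mquot[OF covered_byD(1)[OF dseq_covered(1)[OF us r a]]]
    by (simp add: ultrametric_space_def)
  then show ?thesis
    unfolding cocone_def using metric_map_seq_proj[OF us r a] seq_proj_trans[OF us r a] by blast
qed

lemma factors_uniquely_seq_quot:
  assumes us: "ultrametric_space X d" and r: "Well_order r" and l: "is_limit r a"
    and cc: "cocone r a (seq_quot X d r) (seq_quot_dist X d r) (seq_proj X d r) Y e f"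
  shows "factors_uniquely r a (seq_quot X d r) (seq_quot X d r a) (seq_quot_dist X d r a)
    (\<lambda>b. seq_proj X d r b a) Y e f"
proof -
  interpret wo_rel r using r by (rule wo_rel.intro)
  interpret Y: Metric_space Y e using cc by (simp add: cocone_def)
  have a: "a \<in> Field r" using l by (simp add: is_limit_def)
  have F: "b \<in> Field r" if "b \<in> underS a" for b
    using that by (auto simp: underS_def Field_def)
  note ps = covered_byD(1)[OF dseq_covered(1)[OF us r]]
  obtain b0 where b0: "b0 \<in> underS a" using l unfolding is_limit_def by blast
  \<comment> \<open>By compatibility, all maps of the cocone induce the same function on
    \<open>X\<close>; it is read off at one fixed earlier stage \<open>b0\<close>.\<close>
  let ?h = "\<lambda>x. f b0 (seq_class X d r b0 x)"
  have f_compat: "f b (seq_class X d r b x) = f c (seq_class X d r c x)"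
    if "b \<in> underS a" "c \<in> underS b" "x \<in> X" for b c x
  proof -
    have "f b (seq_proj X d r c b (seq_class X d r c x)) = f c (seq_class X d r c x)"
      using cc that mclass_in_mquot[OF that(3)] unfolding cocone_def by simp
    then show ?thesis using seq_proj_class[OF us r F[OF that(1)] that(2,3)] by simp
  qed
  have f_class: "f b (seq_class X d r b x) = ?h x" if b: "b \<in> underS a" and x: "x \<in> X" for b x
  proof -
    have "b = b0 \<or> b \<in> underS b0 \<or> b0 \<in> underS b"
      using b b0 TOTALS unfolding underS_def Field_def by blast
    then show ?thesis using f_compat[OF b _ x, of b0] f_compat[OF b0 _ x, of b] by auto
  qed
  have f_map: "f b (seq_class X d r b x) \<in> Y"
      "e (f b (seq_class X d r b x)) (f b (seq_class X d r b y)) \<le> dseq X d r b x y"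
    if b: "b \<in> underS a" and xy: "x \<in> X" "y \<in> X" for b x y
  proof -
    have m: "metric_map (seq_quot X d r b) (seq_quot_dist X d r b) Y e (f b)"
      using cc b unfolding cocone_def by blast
    show "f b (seq_class X d r b x) \<in> Y"
      using m mclass_in_mquot[OF xy(1)] unfolding metric_map_def by blast
    have "e (f b (seq_class X d r b x)) (f b (seq_class X d r b y)) \<le>
        seq_quot_dist X d r b (seq_class X d r b x) (seq_class X d r b y)"
      using m mclass_in_mquot[OF xy(1)] mclass_in_mquot[OF xy(2)] unfolding metric_map_def by blast
    then show "e (f b (seq_class X d r b x)) (f b (seq_class X d r b y)) \<le> dseq X d r b x y"
      using mquot_dist_mclass[OF ps[OF F[OF b]] xy] by simp
  qed
  have h_Y: "?h x \<in> Y" if "x \<in> X" for x using f_map(1)[OF b0 that that] .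
  \<comment> \<open>A bound \<open>t\<close> above the limit distance is already met at some earlier
    stage \<open>b\<close>. There \<open>f b\<close> is 1-Lipschitz and induces the same function
    \<open>?h\<close>.\<close>
  have h_le: "e (?h x) (?h y) \<le> dseq X d r a x y" if xy: "x \<in> X" "y \<in> X" for x y
  proof (rule dense_ge)
    fix t assume "dseq X d r a x y < t"
    then obtain b where b: "b \<in> underS a" "dseq X d r b x y < t"
      using dseq_limit_less_iff[OF us r l xy] by blast
    then show "e (?h x) (?h y) \<le> t"
      using f_map(2)[OF b(1) xy] f_class[OF b(1) xy(1)] f_class[OF b(1) xy(2)] by simp
  qed
  \<comment> \<open>The chosen representative does not matter: by \<open>h_le\<close>, points of one
    class have images at distance zero, which are equal because \<open>Y\<close> is a metric
    space.\<close>
  define g where "g = (\<lambda>A\<in>seq_quot X d r a. ?h (SOME x. x \<in> A))"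
  have g: "g (seq_class X d r a x) = ?h x" if x: "x \<in> X" for x
  proof -
    let ?z = "SOME z. z \<in> seq_class X d r a x"
    have "?z \<in> seq_class X d r a x" by (rule someI) (rule mclass_self[OF ps[OF a] x])
    then have z: "?z \<in> X" "dseq X d r a x ?z = 0" by (auto simp: mclass_def)
    then have "e (?h x) (?h ?z) = 0" using h_le[OF x z(1)] by (simp add: order_antisym)
    then have "?h x = ?h ?z" using h_Y x z(1) by simp
    then show ?thesis by (simp add: g_def mclass_in_mquot[OF x])
  qed
  show ?thesis
    unfolding factors_uniquely_def
  proof (intro ex1I[of _ g] conjI ballI)
    show "g \<in> extensional (seq_quot X d r a)" by (simp add: g_def)
    show "metric_map (seq_quot X d r a) (seq_quot_dist X d r a) Y e g"
      unfolding metric_map_def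
    proof (intro conjI Pi_I ballI)
      show "g A \<in> Y" if "A \<in> seq_quot X d r a" for A
        using that by (elim mquotE) (simp add: g h_Y)
      show "e (g A) (g B) \<le> seq_quot_dist X d r a A B"
        if "A \<in> seq_quot X d r a" "B \<in> seq_quot X d r a" for A B
        using that by (elim mquotE) (simp add: g h_le mquot_dist_mclass[OF ps[OF a]])
    qed
    show "g (seq_proj X d r b a A) = f b A" if "b \<in> underS a" "A \<in> seq_quot X d r b" for b A
      using that(2) by (elim mquotE) (simp add: seq_proj_class[OF us r a that(1)] g f_class[OF that(1)])
  next
    fix g' assume g': "g' \<in> extensional (seq_quot X d r a) \<and>
      metric_map (seq_quot X d r a) (seq_quot_dist X d r a) Y e g' \<and>
      (\<forall>b\<in>underS a. \<forall>A\<in>seq_quot X d r b. g' (seq_proj X d r b a A) = f b A)"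
    show "g' = g"
    proof (rule extensionalityI[of _ "seq_quot X d r a"])
      show "g' \<in> extensional (seq_quot X d r a)" using g' by blast
      show "g \<in> extensional (seq_quot X d r a)" by (simp add: g_def)
      fix A assume "A \<in> seq_quot X d r a"
      then obtain x where x: "x \<in> X" "A = seq_class X d r a x" by (rule mquotE)
      \<comment> \<open>Every class at stage \<open>a\<close> is the projection of a class at stage
        \<open>b0\<close>, so the factorization condition at \<open>b0\<close> alone determines the
        mediating map.\<close>
      have "g' (seq_proj X d r b0 a (seq_class X d r b0 x)) = ?h x"
        using g' b0 mclass_in_mquot[OF x(1)] by blast
      then show "g' A = g A" using seq_proj_class[OF us r a b0 x(1)] g[OF x(1)] x(2) by simp
    qed
  qed
qed

theorem theorem7p1:
  fixes X :: "'a set" and d :: "'a \<Rightarrow> 'a \<Rightarrow> real"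
    and r :: "'o rel" and \<alpha> :: 'o
  assumes X: "Polish_ultrametric_space X d"
    and r: "Well_order r" and \<alpha>: "\<alpha> \<in> Field r"
  shows
    "(\<forall>\<beta>\<in>underS r \<alpha>. \<forall>x\<in>X. \<forall>y\<in>X. dseq X d r \<beta> x y \<ge> dseq X d r \<alpha> x y) \<and>

     (pseudo_ultrametric X (dseq X d r \<alpha>) \<and>
     (\<forall>x\<in>X. \<forall>y\<in>X. seq_quot_dist X d r \<alpha> (seq_class X d r \<alpha> x) (seq_class X d r \<alpha> y)
                     = dseq X d r \<alpha> x y) \<and>
     ultrametric_space (seq_quot X d r \<alpha>) (seq_quot_dist X d r \<alpha>)) \<and>

     (is_limit r \<alpha> \<longrightarrow>
     (\<forall>x\<in>X. seq_class X d r \<alpha> x =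
               Metric_space.mtopology X d closure_of (\<Union>\<beta>\<in>underS r \<alpha>. seq_class X d r \<beta> x)
             \<and> closedin (Metric_space.mtopology X d) (seq_class X d r \<alpha> x))) \<and>

     (Metric_space.mcomplete (seq_quot X d r \<alpha>) (seq_quot_dist X d r \<alpha>) \<and>
     Polish_ultrametric_space (seq_quot X d r \<alpha>) (seq_quot_dist X d r \<alpha>)) \<and>

     (\<exists>\<alpha>\<^sub>s\<in>Field omega_1. \<exists>\<sigma>. is_succ omega_1 \<alpha>\<^sub>s \<sigma> \<and>
       (\<forall>x\<in>X. \<forall>y\<in>X. dseq X d omega_1 \<sigma> x y = dseq X d omega_1 \<alpha>\<^sub>s x y) \<and>
       rigid (seq_quot X d omega_1 \<alpha>\<^sub>s) (seq_quot_dist X d omega_1 \<alpha>\<^sub>s)) \<and>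

     (is_limit r \<alpha> \<longrightarrow>
     (\<forall>\<beta>\<in>underS r \<alpha>. \<forall>x\<in>X.
        seq_proj X d r \<beta> \<alpha> (seq_class X d r \<beta> x) = seq_class X d r \<alpha> x) \<and>
     direct_system r \<alpha> (seq_quot X d r) (seq_quot_dist X d r) (seq_proj X d r) \<and>
     cocone r \<alpha> (seq_quot X d r) (seq_quot_dist X d r) (seq_proj X d r)
       (seq_quot X d r \<alpha>) (seq_quot_dist X d r \<alpha>) (\<lambda>\<beta>. seq_proj X d r \<beta> \<alpha>) \<and>
     (\<forall>(Y :: 'y set) e f.
        cocone r \<alpha> (seq_quot X d r) (seq_quot_dist X d r) (seq_proj X d r) Y e f \<longrightarrow>
        factors_uniquely r \<alpha> (seq_quot X d r)
          (seq_quot X d r \<alpha>) (seq_quot_dist X d r \<alpha>) (\<lambda>\<beta>. seq_proj X d r \<beta> \<alpha>) Y e f))"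
proof -
  have us: "ultrametric_space X d" using X by (simp add: Polish_ultrametric_space_def)
  interpret X: Metric_space X d using us by (simp add: ultrametric_space_def)
  note cov = dseq_covered[OF us r \<alpha>]
  note ps = covered_byD(1)[OF cov(1)]
  have F: "\<beta> \<in> Field r" if "\<beta> \<in> underS r \<alpha>" for \<beta>
    using that by (auto simp: underS_def Field_def)
  \<comment> \<open>At a limit every strict bound is met at an earlier stage, which is the
    approximation premise of the closure lemma.\<close>
  have closure: "seq_class X d r \<alpha> x =
      X.mtopology closure_of (\<Union>\<beta>\<in>underS r \<alpha>. seq_class X d r \<beta> x)"
    if l: "is_limit r \<alpha>" and x: "x \<in> X" for x
    using dseq_limit_less_iff[OF us r l x]
    by (intro mclass_eq_closure_of_Union[OF us cov(1) cov(2) dseq_covered(1)[OF us r F] _ x])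
      auto
  have closed: "closedin X.mtopology (seq_class X d r \<alpha> x)" if "is_limit r \<alpha>" "x \<in> X" for x
    unfolding closure[OF that] by (rule closedin_closure_of)
  have polish: "Polish_ultrametric_space (seq_quot X d r \<alpha>) (seq_quot_dist X d r \<alpha>)"
    by (rule Polish_ultrametric_space_mquot[OF X cov(1)])
  show ?thesis
  proof (intro conjI impI)
    show "\<forall>\<beta>\<in>underS r \<alpha>. \<forall>x\<in>X. \<forall>y\<in>X. dseq X d r \<alpha> x y \<le> dseq X d r \<beta> x y"
      using cov(2) by blast
    show "\<forall>x\<in>X. \<forall>y\<in>X. seq_quot_dist X d r \<alpha> (seq_class X d r \<alpha> x) (seq_class X d r \<alpha> y)
        = dseq X d r \<alpha> x y"
      using mquot_dist_mclass[OF ps] by blast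
    show "Metric_space.mcomplete (seq_quot X d r \<alpha>) (seq_quot_dist X d r \<alpha>)"
      using polish by (simp add: Polish_ultrametric_space_def)
    assume l: "is_limit r \<alpha>"
    show "\<forall>x\<in>X. seq_class X d r \<alpha> x =
        X.mtopology closure_of (\<Union>\<beta>\<in>underS r \<alpha>. seq_class X d r \<beta> x)
        \<and> closedin X.mtopology (seq_class X d r \<alpha> x)"
      using closure[OF l] closed[OF l] by blast
    show "\<forall>\<beta>\<in>underS r \<alpha>. \<forall>x\<in>X.
        seq_proj X d r \<beta> \<alpha> (seq_class X d r \<beta> x) = seq_class X d r \<alpha> x"
      using seq_proj_class[OF us r \<alpha>] by blast
    show "\<forall>(Y :: 'y set) e f.
        cocone r \<alpha> (seq_quot X d r) (seq_quot_dist X d r) (seq_proj X d r) Y e f \<longrightarrow>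
        factors_uniquely r \<alpha> (seq_quot X d r)
          (seq_quot X d r \<alpha>) (seq_quot_dist X d r \<alpha>) (\<lambda>\<beta>. seq_proj X d r \<beta> \<alpha>) Y e f"
      using factors_uniquely_seq_quot[OF us r l] by blast
    show "direct_system r \<alpha> (seq_quot X d r) (seq_quot_dist X d r) (seq_proj X d r)"
      by (rule direct_system_seq_quot[OF us r])
    show "cocone r \<alpha> (seq_quot X d r) (seq_quot_dist X d r) (seq_proj X d r)
        (seq_quot X d r \<alpha>) (seq_quot_dist X d r \<alpha>) (\<lambda>\<beta>. seq_proj X d r \<beta> \<alpha>)"
      by (rule cocone_seq_quot[OF us r \<alpha>])
  qed (fact ps ultrametric_space_mquot[OF ps] polish dseq_eventually_rigid[OF X])+
qed

end
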